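(* For each $n\ge 6$, the closed neighborhood ideal $NI(P_n)$ of the path graph $P_n$ does not have linear quotients.
   Context: $P_n$ is the graph on $\{x_1,\dots,x_n\}$ with edges $\{x_i,x_{i+1}\}$, $1\le i\le n-1$. Its closed neighborhood ideal is $NI(P_n)=\langle\prod_{y\in N[v]}y: v\in V(P_n)\rangle\subseteq\mathbb{K}[x_1,\dots,x_n]$ ($\mathbb{K}$ a field), where $N[v]$ is $v$ together with its neighbors. A monomial ideal $I$ has linear quotients if there is an ordering $m_1,\dots,m_r$ of its minimal monomial generators such that for each $1<i\le r$ the colon ideal $(m_1,\dots,m_{i-1}):m_i$ is generated by variables. *)

theory Defs
  imports "HOL-Algebra.Ideal" "HOL-Library.Poly_Mapping"
begin

section \<open>Polynomial rings and monomials\<close>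

text \<open>
  Exponent vectors are finitely supported maps \<open>'v \<Rightarrow>\<^sub>0 nat\<close>, and polynomials are finitely
  supported maps from exponent vectors to coefficients, with the convolution product of
  \<^theory>\<open>HOL-Library.Poly_Mapping\<close>. For a set \<open>V\<close> of variables, \<open>mpoly_ring V\<close> is the polynomial
  ring in exactly the variables \<open>V\<close>, so that the ideals of \<open>HOL-Algebra\<close> apply to it.
\<close>

type_synonym ('v, 'k) mpoly = "('v \<Rightarrow>\<^sub>0 nat) \<Rightarrow>\<^sub>0 'k"

definition mpoly_ring :: "'v set \<Rightarrow> ('v, 'k::field) mpoly ring" where
  "mpoly_ring V =
     \<lparr>carrier = {p. \<forall>e \<in> Poly_Mapping.keys p. Poly_Mapping.keys e \<subseteq> V},
      monoid.mult = (*), one = 1, zero = 0, add = (+)\<rparr>"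

definition var :: "'v \<Rightarrow> ('v, 'k::field) mpoly" where
  "var x = Poly_Mapping.single (Poly_Mapping.single x 1) 1"

definition monomials :: "'v set \<Rightarrow> ('v, 'k::field) mpoly set" where
  "monomials V = {Poly_Mapping.single e 1 | e. Poly_Mapping.keys e \<subseteq> V}"

lemma cring_mpoly_ring: "cring (mpoly_ring V :: ('v, 'k::field) mpoly ring)"
proof (rule cringI)
  show "abelian_group (mpoly_ring V :: ('v, 'k) mpoly ring)"
  proof (rule abelian_groupI)
    fix p :: "('v, 'k) mpoly"
    assume "p \<in> carrier (mpoly_ring V)"
    then show "\<exists>q \<in> carrier (mpoly_ring V). q \<oplus>\<^bsub>mpoly_ring V\<^esub> p = \<zero>\<^bsub>mpoly_ring V\<^esub>"
      by (intro bexI[of _ "- p"]) (auto simp: mpoly_ring_def)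
  next
    fix p q :: "('v, 'k) mpoly"
    assume "p \<in> carrier (mpoly_ring V)" "q \<in> carrier (mpoly_ring V)"
    then show "p \<oplus>\<^bsub>mpoly_ring V\<^esub> q \<in> carrier (mpoly_ring V)"
      using keys_add[of p q] by (auto simp: mpoly_ring_def)
  qed (auto simp: mpoly_ring_def algebra_simps)
  show "comm_monoid (mpoly_ring V :: ('v, 'k) mpoly ring)"
  proof (rule comm_monoidI)
    fix p q :: "('v, 'k) mpoly"
    assume pq: "p \<in> carrier (mpoly_ring V)" "q \<in> carrier (mpoly_ring V)"
    have "Poly_Mapping.keys e \<subseteq> V" if e: "e \<in> Poly_Mapping.keys (p * q)" for e
    proof -
      obtain a b where "e = a + b" "a \<in> Poly_Mapping.keys p" "b \<in> Poly_Mapping.keys q"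
        using subsetD[OF keys_mult e] by auto
      then show ?thesis
        using pq keys_add[of a b] by (fastforce simp: mpoly_ring_def)
    qed
    then show "p \<otimes>\<^bsub>mpoly_ring V\<^esub> q \<in> carrier (mpoly_ring V)"
      by (auto simp: mpoly_ring_def)
  qed (auto simp: mpoly_ring_def algebra_simps)
qed (auto simp: mpoly_ring_def algebra_simps)

section \<open>Linear quotients\<close>

definition colon_ideal :: "('a, 'b) ring_scheme \<Rightarrow> 'a set \<Rightarrow> 'a \<Rightarrow> 'a set" where
  "colon_ideal R J m = {f \<in> carrier R. f \<otimes>\<^bsub>R\<^esub> m \<in> J}"

text \<open>Minimality is with respect to inclusion; a monomial ideal has exactly one such \<open>G\<close>.\<close>

definition minimal_monomial_generators ::
    "'v set \<Rightarrow> ('v, 'k::field) mpoly set \<Rightarrow> ('v, 'k) mpoly set \<Rightarrow> bool" where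
  "minimal_monomial_generators V I G \<longleftrightarrow>
     G \<subseteq> monomials V \<and> Idl\<^bsub>mpoly_ring V\<^esub> G = I \<and>
     (\<forall>H. H \<subset> G \<longrightarrow> Idl\<^bsub>mpoly_ring V\<^esub> H \<noteq> I)"

text \<open>
  The generators are listed from index \<open>0\<close>, so \<open>ms ! i\<close> is preceded by the elements of
  \<open>take i ms\<close>.
\<close>

definition has_linear_quotients :: "'v set \<Rightarrow> ('v, 'k::field) mpoly set \<Rightarrow> bool" where
  "has_linear_quotients V I \<longleftrightarrow>
     (\<exists>ms. distinct ms \<and> minimal_monomial_generators V I (set ms) \<and>
        (\<forall>i. 0 < i \<and> i < length ms \<longrightarrow>
          (\<exists>X \<subseteq> V. colon_ideal (mpoly_ring V) (Idl\<^bsub>mpoly_ring V\<^esub> (set (take i ms))) (ms ! i)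
                     = Idl\<^bsub>mpoly_ring V\<^esub> (var ` X))))"

section \<open>Closed neighborhood ideals\<close>

text \<open>
  A finite simple graph is given by its vertex set \<open>V\<close> and its set \<open>E\<close> of two-element edges;
  a vertex \<open>x\<close> is at the same time the index of the variable \<open>var x\<close>.
\<close>

definition closed_nbhd :: "'v set \<Rightarrow> 'v set set \<Rightarrow> 'v \<Rightarrow> 'v set" where
  "closed_nbhd V E v = insert v {u \<in> V. {v, u} \<in> E}"

definition closed_nbhd_ideal :: "'v set \<Rightarrow> 'v set set \<Rightarrow> ('v, 'k::field) mpoly set" where
  "closed_nbhd_ideal V E = Idl\<^bsub>mpoly_ring V\<^esub> ((\<lambda>v. \<Prod>y \<in> closed_nbhd V E v. var y) ` V)"

definition path_vertices :: "nat \<Rightarrow> nat set" where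
  "path_vertices n = {1..n}"

definition path_edges :: "nat \<Rightarrow> nat set set" where
  "path_edges n = {{i, i + 1} | i. 1 \<le> i \<and> i \<le> n - 1}"

end

theory Submission
  imports Defs
begin

text \<open>
  The two end vertices of \<open>P\<^sub>n\<close> contribute the generators \<open>a = x\<^sub>1 x\<^sub>2\<close> and
  \<open>b = x\<^sub>n\<^sub>-\<^sub>1 x\<^sub>n\<close>. Each of them is divisible by no other generator and hence occurs in every
  monomial generating set. Suppose that \<open>a\<close> is listed before \<open>b\<close>, and let \<open>J\<close> be the ideal of the
  generators listed before \<open>b\<close>. Then \<open>a \<in> J : b\<close>; if this colon ideal is generated by variables,
  one of them divides \<open>a\<close>, so \<open>x b \<in> J\<close> for \<open>x = x\<^sub>1\<close> or \<open>x = x\<^sub>2\<close>. Hence some minimal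
  generator \<open>m\<close> different from \<open>b\<close> divides \<open>x b\<close>. But for \<open>n \<ge> 6\<close> the only closed neighborhood
  contained in \<open>{x, n - 1, n}\<close> is \<open>{n - 1, n}\<close>, so \<open>b\<close> divides \<open>m\<close>, which contradicts minimality.
  The case in which \<open>b\<close> comes first is symmetric.

  The lemma \<open>not_linear_quotients_if_separated\<close> carries out this argument for two members \<open>S\<close>,
  \<open>T\<close> of an arbitrary family of finite sets, under the condition that a member of the family
  contained in \<open>T\<close> plus one element of \<open>S\<close> equals \<open>T\<close>, and vice versa. The algebra enters only
  through \<open>monomial_in_Idl\<close>: a monomial in an ideal generated by monomials is a multiple of
  one of the generators.
\<close>

section \<open>Monomials and their exponent vectors\<close>

abbreviation monomial :: "('v \<Rightarrow>\<^sub>0 nat) \<Rightarrow> ('v, 'k::field) mpoly" where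
  "monomial e \<equiv> Poly_Mapping.single e 1"

text \<open>The exponent vector of the squarefree monomial \<open>\<Prod>y\<in>S. y\<close>; only finite \<open>S\<close> matter.\<close>

definition set_exponent :: "'v set \<Rightarrow> ('v \<Rightarrow>\<^sub>0 nat)" where
  "set_exponent S = (\<Sum>y\<in>S. Poly_Mapping.single y 1)"

lemma lookup_set_exponent:
  assumes "finite S"
  shows "Poly_Mapping.lookup (set_exponent S) y = (if y \<in> S then 1 else 0)"
  using assms unfolding set_exponent_def
  by (induction S) (auto simp: lookup_add lookup_single when_def)

lemma keys_set_exponent: "finite S \<Longrightarrow> Poly_Mapping.keys (set_exponent S) = S"
  by (auto simp: in_keys_iff lookup_set_exponent split: if_splits)

lemma prod_var:
  assumes "finite S"
  shows "(\<Prod>y\<in>S. var y) = (monomial (set_exponent S) :: ('v, 'k::field) mpoly)"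
  using assms unfolding set_exponent_def
  by (induction S) (auto simp: var_def mult_single)

lemma keys_subset_keys_add:
  fixes a c :: "'v \<Rightarrow>\<^sub>0 nat"
  shows "Poly_Mapping.keys a \<subseteq> Poly_Mapping.keys (a + c)"
    and "Poly_Mapping.keys c \<subseteq> Poly_Mapping.keys (a + c)"
  by (auto simp: in_keys_iff lookup_add)

lemma monomial_in_carrier:
  "Poly_Mapping.keys e \<subseteq> V \<Longrightarrow> (monomial e :: ('v, 'k::field) mpoly) \<in> carrier (mpoly_ring V)"
  by (auto simp: mpoly_ring_def)

lemma monomial_inj: "(monomial d :: ('v, 'k::field) mpoly) = monomial e \<Longrightarrow> d = e"
  by (drule arg_cong[where f = Poly_Mapping.keys]) simp

lemma ring_mpoly_ring: "ring (mpoly_ring V :: ('v, 'k::field) mpoly ring)"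
  using cring_mpoly_ring by (rule cring.axioms)

section \<open>Ideals generated by monomials\<close>

text \<open>
  The polynomials all of whose terms are multiples of some \<open>monomial a\<close> with \<open>a \<in> A\<close> form an ideal;
  it contains the ideal generated by these monomials.
\<close>

lemma monomial_in_Idl:
  fixes A :: "('v \<Rightarrow>\<^sub>0 nat) set"
  assumes A: "\<And>a. a \<in> A \<Longrightarrow> Poly_Mapping.keys a \<subseteq> V"
    and e: "(monomial e :: ('v, 'k::field) mpoly) \<in> Idl\<^bsub>mpoly_ring V\<^esub> (monomial ` A)"
  shows "\<exists>a\<in>A. \<exists>c. e = a + c"
proof -
  interpret R: cring "mpoly_ring V :: ('v, 'k) mpoly ring" by (rule cring_mpoly_ring)
  define J :: "('v, 'k) mpoly set" where
    "J = {p \<in> carrier (mpoly_ring V). \<forall>e\<in>Poly_Mapping.keys p. \<exists>a\<in>A. \<exists>c. e = a + c}"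
  have mult: "q * p \<in> J"
    if p: "p \<in> J" and q: "q \<in> carrier (mpoly_ring V)" for p q
  proof -
    have "q * p \<in> carrier (mpoly_ring V)"
      using R.m_closed[of q p] p q by (simp add: J_def mpoly_ring_def)
    moreover have "\<exists>a\<in>A. \<exists>c. e = a + c" if e: "e \<in> Poly_Mapping.keys (q * p)" for e
    proof -
      obtain u w where uw: "e = u + w" "w \<in> Poly_Mapping.keys p"
        using subsetD[OF keys_mult e] by auto
      then obtain a c where "a \<in> A" "w = a + c" using p by (auto simp: J_def)
      then have "e = a + (u + c)" using uw by (simp add: ac_simps)
      then show ?thesis using \<open>a \<in> A\<close> by blast
    qed
    ultimately show ?thesis by (simp add: J_def)
  qed
  have "ideal J (mpoly_ring V)"
  proof (rule idealI)
    show "subgroup J (add_monoid (mpoly_ring V))"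
    proof (rule R.add.subgroupI)
      show "J \<noteq> {}" using R.zero_closed by (auto simp: J_def mpoly_ring_def intro!: exI[of _ 0])
    next
      fix p assume p: "p \<in> J"
      have "\<ominus>\<^bsub>mpoly_ring V\<^esub> p = - p"
      proof (rule R.minus_equality)
        show "- p \<oplus>\<^bsub>mpoly_ring V\<^esub> p = \<zero>\<^bsub>mpoly_ring V\<^esub>" by (simp add: mpoly_ring_def)
      qed (use p in \<open>auto simp: J_def mpoly_ring_def\<close>)
      then show "\<ominus>\<^bsub>mpoly_ring V\<^esub> p \<in> J" using p by (auto simp: J_def mpoly_ring_def)
    next
      fix p q assume pq: "p \<in> J" "q \<in> J"
      then have "p \<oplus>\<^bsub>mpoly_ring V\<^esub> q \<in> carrier (mpoly_ring V)" by (simp add: J_def)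
      then show "p \<oplus>\<^bsub>mpoly_ring V\<^esub> q \<in> J"
        using pq keys_add[of p q] by (auto simp: J_def mpoly_ring_def)
    qed (auto simp: J_def)
  next
    fix p q assume "p \<in> J" "q \<in> carrier (mpoly_ring V :: ('v, 'k) mpoly ring)"
    then have "q * p \<in> J" by (rule mult)
    then show "q \<otimes>\<^bsub>mpoly_ring V\<^esub> p \<in> J" "p \<otimes>\<^bsub>mpoly_ring V\<^esub> q \<in> J"
      by (simp_all add: mpoly_ring_def mult.commute)
  qed (rule ring_mpoly_ring)
  moreover have "monomial ` A \<subseteq> J"
  proof
    fix p :: "('v, 'k) mpoly" assume "p \<in> monomial ` A"
    then obtain a where "a \<in> A" "p = monomial a" by blast
    then show "p \<in> J"
      using monomial_in_carrier[OF A] by (auto simp: J_def intro!: bexI[of _ a] exI[of _ 0])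
  qed
  ultimately have "Idl\<^bsub>mpoly_ring V\<^esub> (monomial ` A) \<subseteq> J"
    by (rule R.genideal_minimal)
  with e show ?thesis by (auto simp: J_def)
qed

lemma mult_in_Idl:
  fixes G :: "('v, 'k::field) mpoly set"
  assumes "G \<subseteq> carrier (mpoly_ring V)" and "p \<in> Idl\<^bsub>mpoly_ring V\<^esub> G"
    and "q \<in> carrier (mpoly_ring V)"
  shows "q * p \<in> Idl\<^bsub>mpoly_ring V\<^esub> G"
proof -
  interpret R: ring "mpoly_ring V :: ('v, 'k) mpoly ring" by (rule ring_mpoly_ring)
  interpret I: ideal "Idl\<^bsub>mpoly_ring V\<^esub> G" "mpoly_ring V" using assms(1) by (rule R.genideal_ideal)
  show ?thesis using I.I_l_closed[OF assms(2,3)] by (simp add: mpoly_ring_def)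
qed

text \<open>
  No minimal monomial generator is a proper multiple of another one: the multiple could be omitted.
\<close>

lemma minimal_monomial_generators_antichain:
  fixes G :: "('v, 'k::field) mpoly set"
  assumes G: "minimal_monomial_generators V I G"
    and b: "monomial b \<in> G" and bc: "monomial (b + c) \<in> G"
  shows "c = 0"
proof (rule ccontr)
  assume "c \<noteq> 0"
  interpret R: ring "mpoly_ring V :: ('v, 'k) mpoly ring" by (rule ring_mpoly_ring)
  define H where "H = G - {monomial (b + c)}"
  have GV: "G \<subseteq> monomials V" and GI: "Idl\<^bsub>mpoly_ring V\<^esub> G = I"
    and min: "\<And>H. H \<subset> G \<Longrightarrow> Idl\<^bsub>mpoly_ring V\<^esub> H \<noteq> I"
    using G by (auto simp: minimal_monomial_generators_def)
  have GR: "G \<subseteq> carrier (mpoly_ring V)"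
    using GV by (auto simp: monomials_def intro!: monomial_in_carrier)
  then have HR: "H \<subseteq> carrier (mpoly_ring V)" by (auto simp: H_def)
  have "(monomial b :: ('v, 'k) mpoly) \<noteq> monomial (b + c)"
    using \<open>c \<noteq> 0\<close> by (auto dest: monomial_inj)
  then have "monomial b \<in> H" using b by (simp add: H_def)
  then have bH: "monomial b \<in> Idl\<^bsub>mpoly_ring V\<^esub> H"
    using R.genideal_self[OF HR] by blast
  from GV bc obtain e
    where e: "(monomial (b + c) :: ('v, 'k) mpoly) = monomial e" "Poly_Mapping.keys e \<subseteq> V"
    unfolding monomials_def by blast
  then have "b + c = e" by (auto dest: monomial_inj)
  then have "Poly_Mapping.keys c \<subseteq> V" using e(2) keys_subset_keys_add(2)[of c b] by blast
  from mult_in_Idl[OF HR bH monomial_in_carrier[OF this]]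
  have "monomial (b + c) \<in> Idl\<^bsub>mpoly_ring V\<^esub> H"
    by (simp add: mult_single add.commute)
  moreover have "H \<subseteq> Idl\<^bsub>mpoly_ring V\<^esub> H" by (rule R.genideal_self[OF HR])
  ultimately have "G \<subseteq> Idl\<^bsub>mpoly_ring V\<^esub> H" by (auto simp: H_def)
  then have "Idl\<^bsub>mpoly_ring V\<^esub> G \<subseteq> Idl\<^bsub>mpoly_ring V\<^esub> H"
    by (rule R.genideal_minimal[OF R.genideal_ideal[OF HR]])
  moreover have "Idl\<^bsub>mpoly_ring V\<^esub> H \<subseteq> Idl\<^bsub>mpoly_ring V\<^esub> G"
    by (rule R.subset_Idl_subset[OF GR]) (auto simp: H_def)
  ultimately have "Idl\<^bsub>mpoly_ring V\<^esub> H = I" using GI by blast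
  moreover have "H \<subset> G" using bc by (auto simp: H_def)
  ultimately show False using min by blast
qed

section \<open>Generating sets of squarefree monomial ideals\<close>

text \<open>
  An ideal \<open>I\<close> generated by the squarefree monomials of a family \<open>\<N>\<close> of finite sets of variables,
  together with its minimal monomial generating set \<open>G\<close>. The family need not be an antichain, so
  it may contain more sets than \<open>G\<close> has monomials.
\<close>

locale squarefree_generators =
  fixes V :: "'v set" and \<N> :: "'v set set" and I G :: "('v, 'k::field) mpoly set"
  assumes fin: "U \<in> \<N> \<Longrightarrow> finite U" and sub: "U \<in> \<N> \<Longrightarrow> U \<subseteq> V"
    and I_def: "I = Idl\<^bsub>mpoly_ring V\<^esub> (monomial ` set_exponent ` \<N>)"
    and G: "minimal_monomial_generators V I G"
begin

sublocale R: cring "mpoly_ring V :: ('v, 'k) mpoly ring" by (rule cring_mpoly_ring)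

text \<open>The exponent vectors of the monomials in \<open>G\<close>.\<close>

definition exponents :: "('v \<Rightarrow>\<^sub>0 nat) set" where
  "exponents = {e. monomial e \<in> G}"

lemma G_eq: "G = monomial ` exponents"
proof
  have "G \<subseteq> monomials V" using G by (simp add: minimal_monomial_generators_def)
  then show "G \<subseteq> monomial ` exponents" by (auto simp: exponents_def monomials_def)
qed (auto simp: exponents_def)

lemma keys_exponents:
  assumes "e \<in> exponents"
  shows "Poly_Mapping.keys e \<subseteq> V"
proof -
  have "(monomial e :: ('v, 'k) mpoly) \<in> monomials V"
    using G assms by (auto simp: minimal_monomial_generators_def exponents_def)
  then obtain d where "(monomial e :: ('v, 'k) mpoly) = monomial d" "Poly_Mapping.keys d \<subseteq> V"
    unfolding monomials_def by blast
  then show ?thesis by (auto dest: monomial_inj)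
qed

lemma G_carrier: "G \<subseteq> carrier (mpoly_ring V)"
proof
  fix p assume "p \<in> G"
  then obtain e where "e \<in> exponents" "p = monomial e" using G_eq[THEN equalityD1] by blast
  then show "p \<in> carrier (mpoly_ring V)" using monomial_in_carrier[OF keys_exponents] by simp
qed

lemma Idl_G: "Idl\<^bsub>mpoly_ring V\<^esub> G = I"
  using G by (simp add: minimal_monomial_generators_def)

lemma Idl_exponents: "Idl\<^bsub>mpoly_ring V\<^esub> (monomial ` exponents) = I"
  using Idl_G by (subst G_eq[symmetric])

lemma exponent_multiple:
  assumes "e \<in> exponents"
  obtains U c where "U \<in> \<N>" "e = set_exponent U + c" "U \<subseteq> Poly_Mapping.keys e"
proof -
  have "monomial e \<in> I"
    using R.genideal_self[OF G_carrier] assms by (auto simp: Idl_G exponents_def)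
  then have "\<exists>a\<in>set_exponent ` \<N>. \<exists>c. e = a + c"
    unfolding I_def
    by (rule monomial_in_Idl[rotated]) (use fin sub in \<open>force simp: keys_set_exponent\<close>)
  then obtain U c where U: "U \<in> \<N>" "e = set_exponent U + c" by blast
  moreover have "U \<subseteq> Poly_Mapping.keys e"
    using keys_subset_keys_add(1)[of "set_exponent U" c] U fin by (simp add: keys_set_exponent)
  ultimately show ?thesis using that by blast
qed

lemma minimal_member_is_generator:
  assumes S: "S \<in> \<N>" and min: "\<And>U. U \<in> \<N> \<Longrightarrow> U \<subseteq> S \<Longrightarrow> U = S"
  shows "monomial (set_exponent S) \<in> G"
proof -
  have "monomial ` set_exponent ` \<N> \<subseteq> carrier (mpoly_ring V :: ('v, 'k) mpoly ring)"
    using sub by (auto simp: keys_set_exponent[OF fin] intro!: monomial_in_carrier) blast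
  from R.genideal_self[OF this] have "monomial (set_exponent S) \<in> I"
    using S by (auto simp: I_def)
  then have "monomial (set_exponent S)
      \<in> Idl\<^bsub>mpoly_ring V\<^esub> (monomial ` exponents :: ('v, 'k) mpoly set)"
    by (simp only: Idl_exponents)
  then have "\<exists>e\<in>exponents. \<exists>c. set_exponent S = e + c"
    by (rule monomial_in_Idl[rotated]) (rule keys_exponents)
  then obtain e c where e: "e \<in> exponents" "set_exponent S = e + c" by blast
  from e(1) obtain U d where U: "U \<in> \<N>" "e = set_exponent U + d" "U \<subseteq> Poly_Mapping.keys e"
    by (rule exponent_multiple)
  have "U \<subseteq> S"
    using U(3) keys_subset_keys_add(1)[of e c] e(2) keys_set_exponent[OF fin[OF S]] by simp
  then have "U = S" using min U(1) by blast
  \<comment> \<open>The monomials with exponents \<open>set_exponent S\<close> and \<open>e\<close> divide each other, so they are equal.\<close>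
  then have "set_exponent S + (d + c) = e + c" using U(2) by (simp add: add.assoc)
  also have "\<dots> = set_exponent S + 0" by (simp add: e(2))
  finally have "d + c = 0" by (rule add_left_imp_eq)
  then have "c = 0" using keys_subset_keys_add(2)[of c d] by simp
  then show ?thesis using e by (simp add: exponents_def)
qed

section \<open>An obstruction to linear quotients\<close>

text \<open>
  Here \<open>monomial (set_exponent S)\<close> is among the generators \<open>M\<close> that precede
  \<open>monomial (set_exponent T)\<close>, and the colon ideal at the latter is generated by the variables
  in \<open>X\<close>.
\<close>

lemma no_linear_colon_if_separated:
  assumes S: "S \<in> \<N>" and T: "T \<in> \<N>"
    and sep: "\<And>x U. x \<in> S \<Longrightarrow> U \<in> \<N> \<Longrightarrow> U \<subseteq> insert x T \<Longrightarrow> U = T"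
    and TG: "monomial (set_exponent T) \<in> G"
    and M: "M \<subseteq> G" "monomial (set_exponent S) \<in> M" "monomial (set_exponent T) \<notin> M"
    and X: "X \<subseteq> V"
    and colon: "colon_ideal (mpoly_ring V) (Idl\<^bsub>mpoly_ring V\<^esub> M) (monomial (set_exponent T))
                  = Idl\<^bsub>mpoly_ring V\<^esub> (var ` X)"
  shows False
proof -
  have MR: "M \<subseteq> carrier (mpoly_ring V)" using M(1) G_carrier by blast
  have SR: "monomial (set_exponent S) \<in> carrier (mpoly_ring V :: ('v, 'k) mpoly ring)"
    and TR: "monomial (set_exponent T) \<in> carrier (mpoly_ring V :: ('v, 'k) mpoly ring)"
    using M TG G_carrier by auto
  have var_image: "var ` X = (monomial ` (\<lambda>x. Poly_Mapping.single x 1) ` X :: ('v, 'k) mpoly set)"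
    by (simp add: var_def image_image)
  have "monomial (set_exponent S) \<in> Idl\<^bsub>mpoly_ring V\<^esub> M"
    using R.genideal_self[OF MR] M(2) by blast
  then have "monomial (set_exponent T) * monomial (set_exponent S) \<in> Idl\<^bsub>mpoly_ring V\<^esub> M"
    by (rule mult_in_Idl[OF MR _ TR])
  then have "monomial (set_exponent S)
      \<in> colon_ideal (mpoly_ring V) (Idl\<^bsub>mpoly_ring V\<^esub> M) (monomial (set_exponent T))"
    using SR by (simp add: colon_ideal_def mpoly_ring_def mult.commute)
  then have "monomial (set_exponent S)
      \<in> Idl\<^bsub>mpoly_ring V\<^esub> (monomial ` (\<lambda>x. Poly_Mapping.single x 1) ` X :: ('v, 'k) mpoly set)"
    by (simp add: colon var_image)
  then have "\<exists>a\<in>(\<lambda>x. Poly_Mapping.single x 1) ` X. \<exists>c. set_exponent S = a + c"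
    by (rule monomial_in_Idl[rotated]) (use X in auto)
  then obtain x c where x: "x \<in> X" "set_exponent S = Poly_Mapping.single x 1 + c" by blast
  have "x \<in> S"
    using keys_subset_keys_add(1)[of "Poly_Mapping.single x 1" c] keys_set_exponent[OF fin[OF S]] x(2)
    by simp
  have "var ` X \<subseteq> carrier (mpoly_ring V :: ('v, 'k) mpoly ring)"
    using X by (auto simp: var_def intro!: monomial_in_carrier)
  from R.genideal_self[OF this] have "var x \<in> Idl\<^bsub>mpoly_ring V\<^esub> (var ` X :: ('v, 'k) mpoly set)"
    using x(1) by blast
  then have "var x * monomial (set_exponent T) \<in> Idl\<^bsub>mpoly_ring V\<^esub> M"
    unfolding colon[symmetric] by (simp add: colon_ideal_def mpoly_ring_def)
  then have xT: "monomial (Poly_Mapping.single x 1 + set_exponent T) \<in> Idl\<^bsub>mpoly_ring V\<^esub> M"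
    by (simp add: var_def mult_single)
  have "M \<subseteq> monomial ` exponents" using M(1) G_eq[THEN equalityD1] by (rule subset_trans)
  then obtain E where E: "E \<subseteq> exponents" and M_eq: "M = monomial ` E"
    by (auto simp: subset_image_iff)
  have "\<exists>e\<in>E. \<exists>c. Poly_Mapping.single x 1 + set_exponent T = e + c"
    by (rule monomial_in_Idl[OF _ xT[unfolded M_eq]]) (use E keys_exponents in blast)
  then obtain e d where e: "monomial e \<in> M" "Poly_Mapping.single x 1 + set_exponent T = e + d"
    using M_eq by blast
  then have "e \<in> exponents" using M(1) by (auto simp: exponents_def)
  then obtain U f where U: "U \<in> \<N>" "e = set_exponent U + f" "U \<subseteq> Poly_Mapping.keys e"
    by (rule exponent_multiple)
  have "Poly_Mapping.keys e \<subseteq> Poly_Mapping.keys (Poly_Mapping.single x 1 + set_exponent T)"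
    unfolding e(2) by (rule keys_subset_keys_add(1))
  also have "\<dots> \<subseteq> insert x T"
    using keys_add[of "Poly_Mapping.single x (1::nat)" "set_exponent T"] fin[OF T]
    by (auto simp: keys_set_exponent)
  finally have "U \<subseteq> insert x T" using U(3) by blast
  then have "U = T" using sep \<open>x \<in> S\<close> U(1) by blast
  then have "f = 0"
    using minimal_monomial_generators_antichain[OF G TG, of f] U(2) e(1) M(1) by auto
  then show False using e(1) M(3) U(2) \<open>U = T\<close> by simp
qed

end

text \<open>
  Nonemptiness of \<open>S\<close> and \<open>T\<close> ensures that the separation conditions make both of them minimal
  in \<open>\<N>\<close>.
\<close>

lemma not_linear_quotients_if_separated:
  fixes V :: "'v set" and \<N> :: "'v set set"
  assumes fin: "\<And>U. U \<in> \<N> \<Longrightarrow> finite U" and sub: "\<And>U. U \<in> \<N> \<Longrightarrow> U \<subseteq> V"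
    and S: "S \<in> \<N>" "S \<noteq> {}" and T: "T \<in> \<N>" "T \<noteq> {}" and "S \<noteq> T"
    and sepT: "\<And>x U. x \<in> S \<Longrightarrow> U \<in> \<N> \<Longrightarrow> U \<subseteq> insert x T \<Longrightarrow> U = T"
    and sepS: "\<And>x U. x \<in> T \<Longrightarrow> U \<in> \<N> \<Longrightarrow> U \<subseteq> insert x S \<Longrightarrow> U = S"
  shows "\<not> has_linear_quotients V
           (Idl\<^bsub>mpoly_ring V\<^esub> (monomial ` set_exponent ` \<N>) :: ('v, 'k::field) mpoly set)"
    (is "\<not> has_linear_quotients V ?I")
proof
  assume "has_linear_quotients V ?I"
  then obtain ms where dist: "distinct ms"
    and G: "minimal_monomial_generators V ?I (set ms)"
    and lin: "\<And>i. 0 < i \<Longrightarrow> i < length ms \<Longrightarrow> \<exists>X \<subseteq> V.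
      colon_ideal (mpoly_ring V) (Idl\<^bsub>mpoly_ring V\<^esub> (set (take i ms))) (ms ! i)
        = Idl\<^bsub>mpoly_ring V\<^esub> (var ` X)"
    unfolding has_linear_quotients_def by blast
  interpret squarefree_generators V \<N> ?I "set ms"
    using fin sub G by unfold_locales auto
  have SG: "monomial (set_exponent S) \<in> set ms"
    by (rule minimal_member_is_generator) (use S T sepS in blast)+
  have TG: "monomial (set_exponent T) \<in> set ms"
    by (rule minimal_member_is_generator) (use S T sepT in blast)+
  obtain i where i: "i < length ms" "ms ! i = monomial (set_exponent S)"
    using SG by (auto simp: in_set_conv_nth)
  obtain j where j: "j < length ms" "ms ! j = monomial (set_exponent T)"
    using TG by (auto simp: in_set_conv_nth)
  have not_before: False
    if A: "A \<in> \<N>" and B: "B \<in> \<N>" and kl: "k < l" "l < length ms"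
      and k: "ms ! k = monomial (set_exponent A)" and l: "ms ! l = monomial (set_exponent B)"
      and sep: "\<And>x U. x \<in> A \<Longrightarrow> U \<in> \<N> \<Longrightarrow> U \<subseteq> insert x B \<Longrightarrow> U = B"
    for A B k l
  proof -
    obtain X where X: "X \<subseteq> V"
      and colon: "colon_ideal (mpoly_ring V) (Idl\<^bsub>mpoly_ring V\<^esub> (set (take l ms))) (ms ! l)
        = Idl\<^bsub>mpoly_ring V\<^esub> (var ` X)"
      using lin[of l] kl by auto
    show False
    proof (rule no_linear_colon_if_separated[OF A B])
      show "monomial (set_exponent B) \<in> set ms" using kl(2) by (simp flip: l)
      show "set (take l ms) \<subseteq> set ms" by (rule set_take_subset)
      show "monomial (set_exponent A) \<in> set (take l ms)"
        unfolding k[symmetric] using kl by (auto simp: in_set_conv_nth intro!: exI[of _ k])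
      show "monomial (set_exponent B) \<notin> set (take l ms)"
        unfolding l[symmetric] using dist kl(2)
        by (auto simp: in_set_conv_nth nth_eq_iff_index_eq)
      show "X \<subseteq> V" by (rule X)
      show "colon_ideal (mpoly_ring V) (Idl\<^bsub>mpoly_ring V\<^esub> (set (take l ms)))
          (monomial (set_exponent B)) = Idl\<^bsub>mpoly_ring V\<^esub> (var ` X)"
        using colon unfolding l .
    qed (rule sep)
  qed
  have "i \<noteq> j"
  proof
    assume "i = j"
    then have "set_exponent S = set_exponent T" using i j by (auto dest: monomial_inj)
    then have "Poly_Mapping.keys (set_exponent S) = Poly_Mapping.keys (set_exponent T)" by simp
    then show False using \<open>S \<noteq> T\<close> by (simp add: keys_set_exponent fin S(1) T(1))
  qed
  then consider "i < j" | "j < i" by linarith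
  then show False
  proof cases
    case 1
    show False by (rule not_before[OF S(1) T(1) 1 j(1) i(2) j(2)]) (rule sepT)
  next
    case 2
    show False by (rule not_before[OF T(1) S(1) 2 i(1) j(2) i(2)]) (rule sepS)
  qed
qed

section \<open>The path graph\<close>

lemma mem_closed_nbhd_path:
  assumes "v \<in> path_vertices n"
  shows "u \<in> closed_nbhd (path_vertices n) (path_edges n) v
           \<longleftrightarrow> 1 \<le> u \<and> u \<le> n \<and> (u = v \<or> u = v + 1 \<or> v = u + 1)"
  using assms unfolding closed_nbhd_def path_vertices_def path_edges_def
  by (auto simp: doubleton_eq_iff)

theorem proposition3p8:
  fixes n :: nat
  assumes "n \<ge> 6"
  shows "\<not> has_linear_quotients (path_vertices n)
           (closed_nbhd_ideal (path_vertices n) (path_edges n) :: (nat, 'k::field) mpoly set)"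
proof -
  let ?V = "path_vertices n"
  let ?N = "closed_nbhd ?V (path_edges n)"
  have sub: "?N v \<subseteq> ?V" if "v \<in> ?V" for v
    using that by (auto simp: closed_nbhd_def)
  then have fin: "finite (?N v)" if "v \<in> ?V" for v
    using that finite_subset by (fastforce simp: path_vertices_def)
  have "(\<lambda>v. \<Prod>y\<in>?N v. var y) ` ?V = (monomial ` set_exponent ` ?N ` ?V :: (nat, 'k) mpoly set)"
    unfolding image_image by (rule image_cong) (simp_all add: prod_var fin)
  then have ideal: "closed_nbhd_ideal ?V (path_edges n)
      = Idl\<^bsub>mpoly_ring ?V\<^esub> (monomial ` set_exponent ` ?N ` ?V :: (nat, 'k) mpoly set)"
    by (simp add: closed_nbhd_ideal_def)
  have ends: "1 \<in> ?V" "n \<in> ?V" using assms by (auto simp: path_vertices_def)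
  have N1: "u \<in> ?N 1 \<longleftrightarrow> u = 1 \<or> u = 2" for u
    unfolding mem_closed_nbhd_path[OF ends(1)] using assms by arith
  have Nn: "u \<in> ?N n \<longleftrightarrow> u = n - 1 \<or> u = n" for u
    unfolding mem_closed_nbhd_path[OF ends(2)] using assms by arith
  show ?thesis unfolding ideal
  proof (rule not_linear_quotients_if_separated)
    show "?N 1 \<in> ?N ` ?V" "?N n \<in> ?N ` ?V"
      using ends by blast+
    show "?N 1 \<noteq> {}" "?N n \<noteq> {}" using N1 Nn by blast+
    have "1 \<in> ?N 1" "1 \<notin> ?N n" unfolding N1 Nn using assms by auto
    then show "?N 1 \<noteq> ?N n" by metis
  next
    fix x U assume x: "x \<in> ?N 1" and U: "U \<in> ?N ` ?V" "U \<subseteq> insert x (?N n)"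
    then obtain v where v: "v \<in> ?V" "U = ?N v" by blast
    have v_bounds: "1 \<le> v" "v \<le> n" using v(1) by (auto simp: path_vertices_def)
    have x_cases: "x = 1 \<or> x = 2" using x N1 by blast
    have within: "u = x \<or> u = n - 1 \<or> u = n" if "u \<in> ?N v" for u
      using that U(2) v(2) Nn by blast
    have "v = n"
    proof (rule ccontr)
      \<comment> \<open>Apart from \<open>v = n\<close>, the set \<open>{x, n - 1, n}\<close> with \<open>x \<le> 2\<close> contains \<open>v\<close> and \<open>v + 1\<close> only for
        \<open>v = n - 1\<close>, and then \<open>v - 1\<close> is outside.\<close>
      assume "v \<noteq> n"
      then have "v + 1 \<in> ?N v" "v \<in> ?N v" "v > 1 \<Longrightarrow> v - 1 \<in> ?N v"
        unfolding mem_closed_nbhd_path[OF v(1)] using v_bounds by auto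
      from this[THEN within] show False
        using assms x_cases v_bounds \<open>v \<noteq> n\<close> by linarith
    qed
    then show "U = ?N n" using v by simp
  next
    fix x U assume x: "x \<in> ?N n" and U: "U \<in> ?N ` ?V" "U \<subseteq> insert x (?N 1)"
    then obtain v where v: "v \<in> ?V" "U = ?N v" by blast
    have v_bounds: "1 \<le> v" "v \<le> n" using v(1) by (auto simp: path_vertices_def)
    have x_cases: "x = n - 1 \<or> x = n" using x Nn by blast
    have within: "u = x \<or> u = 1 \<or> u = 2" if "u \<in> ?N v" for u
      using that U(2) v(2) N1 by blast
    have "v = 1"
    proof (rule ccontr)
      assume "v \<noteq> 1"
      then have "v - 1 \<in> ?N v" "v \<in> ?N v" "v < n \<Longrightarrow> v + 1 \<in> ?N v"
        unfolding mem_closed_nbhd_path[OF v(1)] using v_bounds by auto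
      from this[THEN within] show False
        using assms x_cases v_bounds \<open>v \<noteq> 1\<close> by linarith
    qed
    then show "U = ?N 1" using v by simp
  qed (use sub fin in blast)+
qed

end
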